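(* Let $f(x):=8x^4+16x^3+12x^2+4x+1\in\mathbb{Z}[x]$. Then $f$ satisfies the conditions in Bouniakowsky's conjecture, that is, $f$ is irreducible, has positive leading coefficient, and the gcd of all values $\{f(m) : m\in\mathbb{Z}\}$ equals $1$; so if Bouniakowsky's conjecture holds, then $f(\mathbb{Z})$ contains infinitely many prime numbers. Moreover, if $n\in f(\mathbb{Z})\setminus\{1\}$, then $n\equiv 1\bmod 8$ and $n$ is a congruent number.
   Context: A congruent number is a positive integer $n$ that is the area of a right-angled triangle with rational side lengths, i.e. there exist nonzero $a,b,c\in\mathbb{Q}$ with $a^2+b^2=c^2$ and $ab/2=n$. Bouniakowsky's conjecture states: if $g(x)\in\mathbb{Z}[x]$ is irreducible, has leading coefficient $>0$, and the gcd of all values $\{g(m) : m\in\mathbb{Z}\}$ equals $1$, then $g(m)$ is a prime number for infinitely many $m\in\mathbb{Z}$. Here $f(\mathbb{Z})=\{f(m) : m\in\mathbb{Z}\}$. *)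

theory Defs
  imports "HOL-Computational_Algebra.Computational_Algebra" "HOL-Number_Theory.Number_Theory"
begin

definition congruent_number :: "int \<Rightarrow> bool" where
  "congruent_number n \<longleftrightarrow> n > 0 \<and>
     (\<exists>a b c :: rat. a \<noteq> 0 \<and> b \<noteq> 0 \<and> c \<noteq> 0 \<and> a\<^sup>2 + b\<^sup>2 = c\<^sup>2 \<and> a * b / 2 = of_int n)"

text \<open>Irreducibility is meant in the ring of integer polynomials, not over the rationals. Constant
  polynomials need no separate exclusion: a constant that is irreducible over the integers is, up to
  sign, a prime, and then the gcd of its values is not 1.\<close>

definition bouniakowsky_conditions :: "int poly \<Rightarrow> bool" where
  "bouniakowsky_conditions g \<longleftrightarrow>
     irreducible g \<and> lead_coeff g > 0 \<and> Gcd (range (poly g)) = 1"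

definition bouniakowsky_conjecture :: bool where
  "bouniakowsky_conjecture \<longleftrightarrow>
     (\<forall>g. bouniakowsky_conditions g \<longrightarrow> infinite {m::int. prime (poly g m)})"

text \<open>Coefficients are listed from the constant term upwards:
  $8x^4 + 16x^3 + 12x^2 + 4x + 1$.\<close>

definition f :: "int poly" where
  "f = [:1, 4, 12, 16, 8:]"

end

theory Submission
  imports Defs
begin

text \<open>
  Write \<open>B = m\<^sup>2 + (m + 1)\<^sup>2\<close>, \<open>A = 2m(m + 1)\<close> and \<open>t = 2m + 1\<close>. Then \<open>B - A = 1\<close>,
  \<open>B + A = t\<^sup>2\<close> and \<open>f(m) = A\<^sup>2 + B\<^sup>2 = (t\<^sup>4 + 1) / 2\<close>. Both arithmetic claims come from this.
  As \<open>A\<close> is a multiple of 4 and \<open>B = A + 1\<close>, the value \<open>A\<^sup>2 + B\<^sup>2 = 2A\<^sup>2 + 2A + 1\<close> is 1 modulo 8.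
  The Pythagorean triple generated by \<open>B\<^sup>2\<close> and \<open>A\<^sup>2\<close> has the area
  \<open>A\<^sup>2B\<^sup>2(B\<^sup>4 - A\<^sup>4) = (ABt)\<^sup>2 f(m)\<close>, so that shrinking it by the factor \<open>ABt\<close> gives a rational
  triangle with area \<open>f(m)\<close>; \<open>B\<close> and \<open>t\<close> are odd, so it is degenerate only if \<open>A = 0\<close>, that is,
  if \<open>f(m) = 1\<close>.

  Irreducibility is read off from the values of \<open>f\<close>. If \<open>f = gh\<close> with both factors nonconstant,
  then at each integer where \<open>f\<close> is 1 or a prime, \<open>g\<close> or \<open>h\<close> takes one of the values 1 and -1,
  which happens at most \<open>2 deg g + 2 deg h = 8\<close> times (\<open>card_unit_values_le\<close>). But nine such
  integers are easy to find. A constant factor divides \<open>f(0) = 1\<close>; the same value shows that the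
  gcd of all values is 1. Finally, primes in the range are infinite in number as soon as prime
  arguments are, because a nonconstant polynomial takes each value only finitely often.
\<close>

section \<open>Prime values and irreducibility\<close>

lemma finite_poly_fibre:
  fixes g :: "'a::idom poly"
  assumes "degree g > 0"
  shows "finite {x. poly g x = c}"
proof -
  have "g - [:c:] \<noteq> 0"
    using assms by auto
  from poly_roots_finite[OF this] show ?thesis
    by simp
qed

lemma card_poly_fibre_le:
  fixes g :: "'a::idom poly"
  assumes "degree g > 0"
  shows "card {x. poly g x = c} \<le> degree g"
proof -
  have "g - [:c:] \<noteq> 0"
    using assms by auto
  from card_poly_roots_bound[OF this] have "card {x. poly g x = c} \<le> degree (g - [:c:])"
    by simp
  also have "\<dots> \<le> degree g"
    by (intro degree_diff_le) auto
  finally show ?thesis .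
qed

lemma unit_values_eq:
  fixes g :: "int poly"
  shows "{x. is_unit (poly g x)} = {x. poly g x = 1} \<union> {x. poly g x = -1}"
  by (auto simp: zdvd1_eq abs_if split: if_splits)

lemma card_unit_values_le:
  fixes g :: "int poly"
  assumes "degree g > 0"
  shows "card {x. is_unit (poly g x)} \<le> 2 * degree g"
proof -
  have "card {x. is_unit (poly g x)} \<le> card {x. poly g x = 1} + card {x. poly g x = -1}"
    unfolding unit_values_eq by (rule card_Un_le)
  also have "\<dots> \<le> 2 * degree g"
    using card_poly_fibre_le[OF assms, of 1] card_poly_fibre_le[OF assms, of "-1"] by simp
  finally show ?thesis .
qed

text \<open>
  A factorization of \<open>p\<close> into nonconstant factors forces, at every point of \<open>S\<close>, a unit value of
  one of the factors, and the two factors together have at most \<open>2 deg p\<close> of these. The point \<open>a\<close>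
  with a unit value excludes nontrivial constant factors.
\<close>

lemma irreducible_if_many_prime_values:
  fixes p :: "int poly"
  assumes deg: "degree p > 0"
    and unit: "is_unit (poly p a)"
    and vals: "\<And>x. x \<in> S \<Longrightarrow> is_unit (poly p x) \<or> prime (poly p x)"
    and card: "card S > 2 * degree p"
  shows "irreducible p"
proof (rule irreducibleI)
  show "p \<noteq> 0" and "\<not> is_unit p"
    using deg by (auto simp: is_unit_poly_iff)
next
  fix g h assume p: "p = g * h"
  have const: "is_unit q" if "q dvd p" "degree q = 0" for q
  proof -
    obtain c where q: "q = [:c:]"
      using degree_eq_zeroE[OF \<open>degree q = 0\<close>] .
    have "c dvd poly p a"
      using \<open>q dvd p\<close> by (auto elim!: dvdE simp: q)
    hence "is_unit c"
      using unit by (rule dvd_trans)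
    thus ?thesis
      using q by (simp add: is_unit_const_poly_iff)
  qed
  show "is_unit g \<or> is_unit h"
  proof (rule ccontr)
    assume "\<not> (is_unit g \<or> is_unit h)"
    hence dg: "degree g > 0" and dh: "degree h > 0"
      using const[of g] const[of h] by (auto simp: p)
    let ?U = "{x. is_unit (poly g x)}" and ?V = "{x. is_unit (poly h x)}"
    have "S \<subseteq> ?U \<union> ?V"
    proof
      fix x assume "x \<in> S"
      have px: "poly p x = poly g x * poly h x"
        by (simp add: p)
      from vals[OF \<open>x \<in> S\<close>] have "is_unit (poly g x) \<or> is_unit (poly h x)"
      proof
        assume "is_unit (poly p x)"
        thus ?thesis
          unfolding px is_unit_mult_iff by blast
      next
        assume "prime (poly p x)"
        hence "irreducible (poly p x)"
          by (intro prime_elem_imp_irreducible prime_imp_prime_elem)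
        thus ?thesis
          using px by (rule irreducibleD)
      qed
      thus "x \<in> ?U \<union> ?V"
        by blast
    qed
    moreover have "finite (?U \<union> ?V)"
      unfolding unit_values_eq by (intro finite_UnI finite_poly_fibre dg dh)
    ultimately have "card S \<le> card (?U \<union> ?V)"
      by (rule card_mono[rotated])
    also have "\<dots> \<le> card ?U + card ?V"
      by (rule card_Un_le)
    also have "\<dots> \<le> 2 * degree g + 2 * degree h"
      by (intro add_mono card_unit_values_le dg dh)
    also have "\<dots> = 2 * degree p"
      unfolding p using dg dh by (subst degree_mult_eq) auto
    finally show False
      using card by simp
  qed
qed

lemma prime_by_trial_division:
  fixes n k :: nat
  assumes "n > 1" "n < k\<^sup>2" and *: "\<forall>d\<in>set [2..<k]. \<not> d dvd n"
  shows "prime n"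
proof -
  have "d = 1" if "d dvd n" "d\<^sup>2 \<le> n" for d
  proof (rule ccontr)
    assume "d \<noteq> 1"
    have "d\<^sup>2 < k\<^sup>2"
      using that(2) assms(2) by (rule le_less_trans)
    hence "d < k"
      by (rule power_less_imp_less_base) simp
    moreover have "d \<noteq> 0"
      using that(1) assms(1) by (intro notI) simp
    ultimately show False
      using * that(1) \<open>d \<noteq> 1\<close> by auto
  qed
  moreover have "n \<noteq> 1"
    using assms(1) by simp
  ultimately show ?thesis
    unfolding prime_divisor_sqrt by blast
qed

section \<open>The quartic polynomial\<close>

lemma degree_f: "degree f = 4"
  by (simp add: f_def)

lemma poly_f: "poly f m = 8 * m ^ 4 + 16 * m ^ 3 + 12 * m\<^sup>2 + 4 * m + 1"
  by (simp add: f_def algebra_simps power2_eq_square power3_eq_cube power4_eq_xxxx)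

text \<open>
  Since \<open>f(x) = f(-1 - x)\<close>, values come in pairs: 1 at 0 and -1, 41 at 1 and -2, 313 at 2 and -3,
  1201 at 3 and -4. These eight points are one short of the required nine. At 4 the value is
  17 * 193, and at 5 it is the prime 7321.
\<close>

lemma irreducible_f: "irreducible f"
proof (rule irreducible_if_many_prime_values)
  show "degree f > 0"
    by (simp add: degree_f)
  show "is_unit (poly f 0)"
    by (simp add: f_def)
  let ?S = "{0, -1, 1, -2, 2, -3, 3, -4, 5 :: int}"
  show "card ?S > 2 * degree f"
    by (simp add: degree_f)
  show "is_unit (poly f x) \<or> prime (poly f x)" if "x \<in> ?S" for x
  proof -
    have "prime (1201::nat)" and "prime (7321::nat)"
      by (rule prime_by_trial_division[where k = 35], simp_all del: prime_nat_numeral_eq)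
         (rule prime_by_trial_division[where k = 86], simp_all del: prime_nat_numeral_eq)
    moreover have "prime (41::nat)" and "prime (313::nat)"
      by simp_all
    moreover have "poly f x \<in> {1, 41, 313, 1201, 7321}"
      using that by (auto simp: f_def)
    ultimately show ?thesis
      by (auto simp del: prime_nat_numeral_eq)
  qed
qed

lemma bouniakowsky_conditions_f: "bouniakowsky_conditions f"
  unfolding bouniakowsky_conditions_def
proof (intro conjI irreducible_f)
  show "lead_coeff f > 0"
    by (simp add: f_def)
  have "poly f 0 \<in> range (poly f)"
    by blast
  hence "Gcd (range (poly f)) dvd poly f 0"
    by (rule Gcd_dvd)
  thus "Gcd (range (poly f)) = 1"
    by (simp add: f_def)
qed

lemma infinite_primes_in_range:
  assumes "degree g > 0" and inf: "infinite {m::int. prime (poly g m)}"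
  shows "infinite {p \<in> range (poly g). prime p}"
proof
  assume "finite {p \<in> range (poly g). prime p}"
  hence "finite (\<Union>p\<in>{p \<in> range (poly g). prime p}. {m. poly g m = p})"
    using finite_poly_fibre[OF assms(1)] by (intro finite_UN_I) auto
  moreover have "{m. prime (poly g m)} \<subseteq> (\<Union>p\<in>{p \<in> range (poly g). prime p}. {m. poly g m = p})"
    by auto
  ultimately show False
    using inf finite_subset by blast
qed

lemma f_cong_1_mod_8: "[poly f m = 1] (mod 8)"
proof -
  have "even (m * (m + 1))"
    by simp
  then obtain k where k: "m * (m + 1) = 2 * k"
    by (elim evenE)
  have "poly f m - 1 = 8 * (m * (m + 1))\<^sup>2 + 4 * (m * (m + 1))"
    by (simp add: poly_f algebra_simps power2_eq_square power3_eq_cube power4_eq_xxxx)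
  also have "\<dots> = 8 * (4 * k\<^sup>2 + k)"
    by (simp add: k power2_eq_square)
  finally show ?thesis
    by (simp add: cong_iff_dvd_diff)
qed

text \<open>
  The triangle has the sides \<open>(B\<^sup>4 - A\<^sup>4) / (ABt)\<close>, \<open>2A\<^sup>2B\<^sup>2 / (ABt)\<close> and \<open>(A\<^sup>4 + B\<^sup>4) / (ABt)\<close>. The
  hypothesis on \<open>B\<^sup>2 - A\<^sup>2\<close> is what makes \<open>A\<^sup>2 + B\<^sup>2\<close> the area up to a rational square.
\<close>

lemma congruent_number_sum_of_squares:
  fixes A B t :: int
  assumes sq: "B\<^sup>2 - A\<^sup>2 = t\<^sup>2" and nz: "A \<noteq> 0" "B \<noteq> 0" "t \<noteq> 0"
  shows "congruent_number (A\<^sup>2 + B\<^sup>2)"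
proof -
  define u v w :: rat where "u = of_int A" and "v = of_int B" and "w = of_int t"
  have uvw: "u \<noteq> 0" "v \<noteq> 0" "w \<noteq> 0"
    using nz by (auto simp: u_def v_def w_def)
  have "(of_int (B\<^sup>2 - A\<^sup>2) :: rat) = of_int (t\<^sup>2)"
    by (simp only: sq)
  hence w2: "w\<^sup>2 = v\<^sup>2 - u\<^sup>2"
    by (simp add: u_def v_def w_def)
  define a b c where "a = (v ^ 4 - u ^ 4) / (u * v * w)"
    and "b = 2 * u\<^sup>2 * v\<^sup>2 / (u * v * w)" and "c = (u ^ 4 + v ^ 4) / (u * v * w)"
  have diff: "v ^ 4 - u ^ 4 = w\<^sup>2 * (u\<^sup>2 + v\<^sup>2)"
    unfolding w2 by (simp add: algebra_simps power2_eq_square power4_eq_xxxx)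
  have pos: "u\<^sup>2 + v\<^sup>2 \<noteq> 0" "u ^ 4 + v ^ 4 \<noteq> 0"
    using uvw by (auto simp: add_nonneg_eq_0_iff)
  have "a \<noteq> 0" "b \<noteq> 0" "c \<noteq> 0"
    using uvw pos by (simp_all add: a_def b_def c_def diff)
  moreover have "a\<^sup>2 + b\<^sup>2 = c\<^sup>2"
  proof -
    have "(v ^ 4 - u ^ 4)\<^sup>2 + (2 * u\<^sup>2 * v\<^sup>2)\<^sup>2 = (u ^ 4 + v ^ 4)\<^sup>2"
      by (simp add: algebra_simps power2_eq_square power4_eq_xxxx)
    thus ?thesis
      by (simp add: a_def b_def c_def power_divide flip: add_divide_distrib)
  qed
  moreover have "a * b / 2 = of_int (A\<^sup>2 + B\<^sup>2)"
  proof -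
    have "a * b / 2 = u\<^sup>2 + v\<^sup>2"
      using uvw by (simp add: a_def b_def diff field_simps power2_eq_square)
    thus ?thesis
      by (simp add: u_def v_def)
  qed
  moreover have "A\<^sup>2 + B\<^sup>2 > 0"
    using nz by (simp add: sum_power2_gt_zero_iff)
  ultimately show ?thesis
    unfolding congruent_number_def by blast
qed

lemma congruent_number_f:
  assumes "poly f m \<noteq> 1"
  shows "congruent_number (poly f m)"
proof -
  define A B where "A = 2 * m * (m + 1)" and "B = m\<^sup>2 + (m + 1)\<^sup>2"
  have f_eq: "poly f m = A\<^sup>2 + B\<^sup>2"
    by (simp add: poly_f A_def B_def algebra_simps power2_eq_square power3_eq_cube power4_eq_xxxx)
  have B_eq: "B = A + 1"
    by (simp add: A_def B_def algebra_simps power2_eq_square)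
  have "A \<noteq> 0"
    using assms by (auto simp: f_eq B_eq)
  moreover have "B \<noteq> 0" and "2 * m + 1 \<noteq> 0"
  proof -
    have "odd B" and "odd (2 * m + 1)"
      by (simp_all add: B_eq A_def)
    thus "B \<noteq> 0" and "2 * m + 1 \<noteq> 0"
      by fastforce+
  qed
  moreover have "B\<^sup>2 - A\<^sup>2 = (2 * m + 1)\<^sup>2"
    by (simp add: A_def B_def algebra_simps power2_eq_square)
  ultimately show ?thesis
    unfolding f_eq by (intro congruent_number_sum_of_squares)
qed

theorem proposition3p1:
  shows "bouniakowsky_conditions f
    \<and> (bouniakowsky_conjecture \<longrightarrow> infinite {p \<in> range (poly f). prime p})
    \<and> (\<forall>n \<in> range (poly f) - {1}. [n = 1] (mod 8) \<and> congruent_number n)"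
proof (intro conjI impI ballI)
  show "bouniakowsky_conditions f"
    by (rule bouniakowsky_conditions_f)
  show "infinite {p \<in> range (poly f). prime p}" if bouniakowsky_conjecture
    using that bouniakowsky_conditions_f unfolding bouniakowsky_conjecture_def
    by (intro infinite_primes_in_range) (auto simp: degree_f)
next
  fix n assume "n \<in> range (poly f) - {1}"
  then obtain m where n: "n = poly f m" and "poly f m \<noteq> 1"
    by auto
  show "[n = 1] (mod 8)"
    unfolding n by (rule f_cong_1_mod_8)
  show "congruent_number n"
    unfolding n by (rule congruent_number_f) fact
qed

end
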